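(* Let $S$ be a Polish space, let $M: S \rightsquigarrow \mathbb{R}_+\times S$ be a stochastic relation with $M(s)(\mathbb{R}_+\times S)=1$ for all $s\in S$, let $P$ be a countable set of atomic propositions, and let $\ell: P\to\mathcal{B}(S)$ be a map. Interpret the formulas of the logic CSL over $M$ and $\ell$ (as described in the context). Then for every state formula $\xi$ the set $[\![\xi]\!]=\{s\in S\mid s\models\xi\}$ is a Borel subset of $S$, and for every path formula $\xi$ the set $[\![\xi]\!]=\{\sigma\mid\sigma\models\xi\}$ is a Borel subset of $(S\times\mathbb{R}_+)^\infty$.
   Context: $\mathbb{R}_+=[0,\infty)$; $\mathcal{B}(\cdot)$ denotes Borel sets; $Z^\infty$ is the countably infinite product of $Z$ with itself, with the product topology. A stochastic relation $K: X\rightsquigarrow Y$ between Polish spaces assigns to each $x\in X$ a subprobability measure $K(x)$ on $\mathcal{B}(Y)$ such that $x\mapsto K(x)(B)$ is Borel measurable for every $B\in\mathcal{B}(Y)$. Infinite-path kernel. Put $M_1:=M$ and, for Borel $D\subseteq(\mathbb{R}_+\times S)^{n+1}$, $$M_{n+1}(s_0)(D):=\int_{(\mathbb{R}_+\times S)^n}M(s_n)(D_{t_0,s_1,\dots,t_{n-1},s_n})\,M_n(s_0)(d\langle t_0,s_1,\dots,t_{n-1},s_n\rangle),$$ where $D_{t_0,s_1,\dots,t_{n-1},s_n}=\{\langle t,s\rangle\mid\langle t_0,s_1,\dots,t_{n-1},s_n,t,s\rangle\in D\}$. Then $M_\infty: S\rightsquigarrow(\mathbb{R}_+\times S)^\infty$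 is the unique stochastic relation with $M_\infty(s)(A\times\prod_{k>n}(\mathbb{R}_+\times S))=M_n(s)(A)$ for all $s\in S$, $n\in\mathbb{N}$ and $A\in\mathcal{B}((\mathbb{R}_+\times S)^n)$. Paths. A path is an element $\sigma=\langle s_0,t_0,s_1,t_1,\dots\rangle$ of $(S\times\mathbb{R}_+)^\infty$; put $\sigma[i]:=s_i$ and $\delta(\sigma,i):=t_i$. For $t\in\mathbb{R}_+$, let $\sigma@t:=\sigma[j]$, where $j$ is the smallest index $k$ with $t<\sum_{i=0}^k t_i$, if such an index exists; otherwise $\sigma@t:=\#$, a new symbol not in $S\cup\mathbb{R}_+$ (which satisfies no state formula). For $s\in S$ and $\tau\in(\mathbb{R}_+\times S)^\infty$, $\langle s,\tau\rangle$ is regarded as an element of $(S\times\mathbb{R}_+)^\infty$. Syntax of CSL. State formulas: $\varphi::=\top\mid a\mid\neg\varphi\mid\varphi\wedge\varphi'\mid\mathcal{S}_{\bowtie p}(\varphi)\mid\mathcal{P}_{\bowtie p}(\psi)$, with $a\in P$, $\psi$ a path formula, $\bowtie\,\in\{<,\le,\ge,>\}$, and $p\in[0,1]$ rational. Path formulas: $\psi::=\mathcal{X}^I\varphi\mid\varphi\,\mathcal{U}^I\varphi'$, with $\varphi,\varphi'$ state formulas and $I\subseteq\mathbb{R}_+$ a closed interval with rational bounds (including $I=\mathbb{R}_+$). Semantics. $s\models\top$ always; $s\models a$ iff $s\in\ell(a)$; $\wedge$ and $\neg$ as usual; $s\models\mathcal{S}_{\bowtie p}(\varphi)$ iff $\lim_{t\to\infty}M_\infty(s)(\{\tau\mid\langle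 s,\tau\rangle@t\models\varphi\})$ exists and is $\bowtie p$; $s\models\mathcal{P}_{\bowtie p}(\psi)$ iff $M_\infty(s)(\{\tau\mid\langle s,\tau\rangle\models\psi\})\bowtie p$; $\sigma\models\mathcal{X}^I\varphi$ iff $\sigma[1]\models\varphi$ and $\delta(\sigma,0)\in I$; $\sigma\models\varphi_1\,\mathcal{U}^I\varphi_2$ iff there is $t\in I$ with $\sigma@t\models\varphi_2$ and $\sigma@t'\models\varphi_1$ for all $t'\in[0,t[$. *)

theory Defs
  imports "HOL-Probability.Probability"
begin

definition stochastic_relation :: "'x measure \<Rightarrow> 'y measure \<Rightarrow> ('x \<Rightarrow> 'y measure) \<Rightarrow> bool" where
  "stochastic_relation X Y K \<longleftrightarrow> K \<in> X \<rightarrow>\<^sub>M subprob_algebra Y"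

text \<open>The half line \<open>[0,\<infinity>)\<close> is a subspace of the reals, so the spaces built from it carry
  the trace of the Borel sets of the ambient type.\<close>

definition timed_state :: "(real \<times> 's::polish_space) measure" where
  "timed_state = restrict_space borel ({0..} \<times> UNIV)"

definition timed_seq :: "(nat \<Rightarrow> real \<times> 's::polish_space) measure" where
  "timed_seq = restrict_space borel {\<tau>. \<forall>i. 0 \<le> fst (\<tau> i)}"

definition path_space :: "(nat \<Rightarrow> 's::polish_space \<times> real) measure" where
  "path_space = restrict_space borel {\<sigma>. \<forall>i. 0 \<le> snd (\<sigma> i)}"

text \<open>\<open>fin_kernel M n\<close> is the kernel \<open>M\<^sub>n\<^sub>+\<^sub>1\<close>; a tuple \<open>\<langle>t\<^sub>0, s\<^sub>1, \<dots>, t\<^sub>n, s\<^sub>n\<^sub>+\<^sub>1\<rangle>\<close> is the function on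
  \<open>{..n}\<close> with value \<open>(t\<^sub>i, s\<^sub>i\<^sub>+\<^sub>1)\<close> at \<open>i\<close>. On these finite powers of a Polish space the product
  sigma-algebra is the Borel one.\<close>

primrec fin_kernel ::
  "('s::polish_space \<Rightarrow> (real \<times> 's) measure) \<Rightarrow> nat \<Rightarrow> 's \<Rightarrow> (nat \<Rightarrow> real \<times> 's) measure" where
  "fin_kernel M 0 s = distr (M s) (\<Pi>\<^sub>M i\<in>{..0}. timed_state) (\<lambda>y. \<lambda>i\<in>{..0}. y)"
| "fin_kernel M (Suc n) s =
     measure_of (space (\<Pi>\<^sub>M i\<in>{..Suc n}. timed_state)) (sets (\<Pi>\<^sub>M i\<in>{..Suc n}. timed_state))
       (\<lambda>D. \<integral>\<^sup>+x. emeasure (M (snd (x n))) {y \<in> space timed_state. x(Suc n := y) \<in> D} \<partial>fin_kernel M n s)"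

definition path_kernel ::
  "('s::polish_space \<Rightarrow> (real \<times> 's) measure) \<Rightarrow> 's \<Rightarrow> (nat \<Rightarrow> real \<times> 's) measure" where
  "path_kernel M = (THE K. stochastic_relation borel timed_seq K \<and>
     (\<forall>s n. \<forall>A \<in> sets (\<Pi>\<^sub>M i\<in>{..n}. timed_state).
        emeasure (K s) {\<tau> \<in> space timed_seq. restrict \<tau> {..n} \<in> A} = emeasure (fin_kernel M n s) A))"

text \<open>\<open>\<langle>s, \<tau>\<rangle>\<close> regroups \<open>\<tau> = \<langle>t\<^sub>0, s\<^sub>1, t\<^sub>1, s\<^sub>2, \<dots>\<rangle>\<close> as \<open>\<langle>(s, t\<^sub>0), (s\<^sub>1, t\<^sub>1), \<dots>\<rangle>\<close>.\<close>

definition path_cons :: "'s \<Rightarrow> (nat \<Rightarrow> real \<times> 's) \<Rightarrow> nat \<Rightarrow> 's \<times> real" where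
  "path_cons s \<tau> i = (case i of 0 \<Rightarrow> s | Suc j \<Rightarrow> snd (\<tau> j), fst (\<tau> i))"

definition state_nth :: "(nat \<Rightarrow> 's \<times> real) \<Rightarrow> nat \<Rightarrow> 's" where
  "state_nth \<sigma> i = fst (\<sigma> i)"

definition delay :: "(nat \<Rightarrow> 's \<times> real) \<Rightarrow> nat \<Rightarrow> real" where
  "delay \<sigma> i = snd (\<sigma> i)"

text \<open>\<open>None\<close> plays the role of the extra symbol \<open>#\<close>.\<close>

definition state_at :: "(nat \<Rightarrow> 's \<times> real) \<Rightarrow> real \<Rightarrow> 's option" where
  "state_at \<sigma> t =
     (if \<exists>k. t < (\<Sum>i\<le>k. delay \<sigma> i)
      then Some (state_nth \<sigma> (LEAST k. t < (\<Sum>i\<le>k. delay \<sigma> i)))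
      else None)"

datatype cmp = LT | LE | GE | GT

primrec cmp_rel :: "cmp \<Rightarrow> real \<Rightarrow> real \<Rightarrow> bool" where
  "cmp_rel LT x y \<longleftrightarrow> x < y"
| "cmp_rel LE x y \<longleftrightarrow> x \<le> y"
| "cmp_rel GE x y \<longleftrightarrow> x \<ge> y"
| "cmp_rel GT x y \<longleftrightarrow> x > y"

datatype 'p state_formula =
    Top
  | Atom 'p
  | Neg "'p state_formula"
  | Conj "'p state_formula" "'p state_formula"
  | Steady cmp rat "'p state_formula"
  | Prob cmp rat "'p path_formula"
and 'p path_formula =
    Next "real set" "'p state_formula"
  | Until "'p state_formula" "real set" "'p state_formula"

definition csl_interval :: "real set \<Rightarrow> bool" where
  "csl_interval I \<longleftrightarrow> (\<exists>a\<in>\<rat>. 0 \<le> a \<and> (I = {a..} \<or> (\<exists>b\<in>\<rat>. a \<le> b \<and> I = {a..b})))"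

text \<open>The formulas of CSL over the atomic propositions \<open>P\<close>, carved out of the raw syntax.\<close>

primrec csl_state :: "'p set \<Rightarrow> 'p state_formula \<Rightarrow> bool"
    and csl_path :: "'p set \<Rightarrow> 'p path_formula \<Rightarrow> bool" where
  "csl_state P Top \<longleftrightarrow> True"
| "csl_state P (Atom a) \<longleftrightarrow> a \<in> P"
| "csl_state P (Neg \<phi>) \<longleftrightarrow> csl_state P \<phi>"
| "csl_state P (Conj \<phi> \<phi>') \<longleftrightarrow> csl_state P \<phi> \<and> csl_state P \<phi>'"
| "csl_state P (Steady c p \<phi>) \<longleftrightarrow> 0 \<le> p \<and> p \<le> 1 \<and> csl_state P \<phi>"
| "csl_state P (Prob c p \<psi>) \<longleftrightarrow> 0 \<le> p \<and> p \<le> 1 \<and> csl_path P \<psi>"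
| "csl_path P (Next I \<phi>) \<longleftrightarrow> csl_interval I \<and> csl_state P \<phi>"
| "csl_path P (Until \<phi> I \<phi>') \<longleftrightarrow> csl_interval I \<and> csl_state P \<phi> \<and> csl_state P \<phi>'"

text \<open>The test \<open>\<exists>s'. state_at \<sigma> t = Some s' \<and> \<dots>\<close> fails at \<open>#\<close>,
  also for \<open>Top\<close> and for negations.\<close>

primrec sat_state :: "('s::polish_space \<Rightarrow> (real \<times> 's) measure) \<Rightarrow> ('p \<Rightarrow> 's set)
      \<Rightarrow> 'p state_formula \<Rightarrow> 's \<Rightarrow> bool"
    and sat_path :: "('s::polish_space \<Rightarrow> (real \<times> 's) measure) \<Rightarrow> ('p \<Rightarrow> 's set)
      \<Rightarrow> 'p path_formula \<Rightarrow> (nat \<Rightarrow> 's \<times> real) \<Rightarrow> bool" where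
  "sat_state M lab Top = (\<lambda>s. True)"
| "sat_state M lab (Atom a) = (\<lambda>s. s \<in> lab a)"
| "sat_state M lab (Neg \<phi>) = (\<lambda>s. \<not> sat_state M lab \<phi> s)"
| "sat_state M lab (Conj \<phi> \<phi>') = (\<lambda>s. sat_state M lab \<phi> s \<and> sat_state M lab \<phi>' s)"
| "sat_state M lab (Steady c p \<phi>) = (\<lambda>s. \<exists>L.
     ((\<lambda>t. measure (path_kernel M s)
        {\<tau> \<in> space timed_seq. \<exists>s'. state_at (path_cons s \<tau>) t = Some s' \<and> sat_state M lab \<phi> s'})
       \<longlongrightarrow> L) at_top \<and> cmp_rel c L (of_rat p))"
| "sat_state M lab (Prob c p \<psi>) = (\<lambda>s.
     cmp_rel c (measure (path_kernel M s) {\<tau> \<in> space timed_seq. sat_path M lab \<psi> (path_cons s \<tau>)})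
       (of_rat p))"
| "sat_path M lab (Next I \<phi>) = (\<lambda>\<sigma>. sat_state M lab \<phi> (state_nth \<sigma> 1) \<and> delay \<sigma> 0 \<in> I)"
| "sat_path M lab (Until \<phi> I \<phi>') = (\<lambda>\<sigma>. \<exists>t\<in>I.
     (\<exists>s'. state_at \<sigma> t = Some s' \<and> sat_state M lab \<phi>' s') \<and>
     (\<forall>t'\<in>{0..<t}. \<exists>s'. state_at \<sigma> t' = Some s' \<and> sat_state M lab \<phi> s'))"

end

theory Submission
  imports Defs
begin

text \<open>The infinite-path kernel exists by the Ionescu-Tulcea theorem, and it is measurable and unique
  because the cylinder sets generate the Borel sets of the sequence space. Every path occupies a fixed
  state on a right-open interval, so \<open>\<sigma>@t\<close> is locally constant to the right of every \<open>t\<close>.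
  Hence the quantification over \<open>t' \<in> [0,t[\<close> in an until formula can be restricted to rational times,
  and, by dominated convergence, \<open>t \<mapsto> M\<^sub>\<infinity>(s)({\<tau>. \<langle>s,\<tau>\<rangle>@t \<Turnstile> \<phi>})\<close> is right-continuous, so that its
  limit at infinity is determined by rational times as well. Measurability then follows by induction
  on formulas.\<close>

section \<open>The infinite-path kernel\<close>

lemma space_timed_seq: "space timed_seq = space (\<Pi>\<^sub>M i\<in>UNIV. timed_state)"
  by (auto simp: timed_seq_def timed_state_def space_restrict_space space_PiM PiE_iff mem_Times_iff)

lemma measurable_coord:
  "(\<lambda>f. f i) \<in> borel_measurable (borel :: ('i::countable \<Rightarrow> 'b::second_countable_topology) measure)"
  using measurable_component_singleton[of i UNIV "\<lambda>_::'i. borel::'b measure"]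
  by (simp add: measurable_cong_sets[OF sets_PiM_equal_borel refl])

lemma measurable_fst_borel [measurable]:
  "fst \<in> borel_measurable (borel :: ('a::second_countable_topology \<times> 'b::second_countable_topology) measure)"
  by (simp add: borel_prod[symmetric])

lemma measurable_snd_borel [measurable]:
  "snd \<in> borel_measurable (borel :: ('a::second_countable_topology \<times> 'b::second_countable_topology) measure)"
  by (simp add: borel_prod[symmetric])

lemma sets_subset_of_measurable_ident:
  assumes "(\<lambda>x. x) \<in> A \<rightarrow>\<^sub>M B" "space A = space B"
  shows "sets B \<subseteq> sets A"
proof
  fix X assume "X \<in> sets B"
  with measurable_sets[OF assms(1) this] show "X \<in> sets A"
    using assms(2) sets.sets_into_space[of X B] by (simp add: Int_absorb2)
qed

text \<open>The identity is measurable in both directions: coordinates are Borel, and a map into a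
  countable power of a second-countable space is Borel as soon as its coordinates are. This lets
  measures built on the product sigma-algebra serve on \<open>timed_seq\<close>.\<close>

lemma sets_timed_seq: "sets (timed_seq :: (nat \<Rightarrow> real \<times> 's::polish_space) measure)
  = sets (PiM UNIV (\<lambda>_. timed_state))"
proof
  have "(\<lambda>x. x) \<in> timed_seq \<rightarrow>\<^sub>M PiM UNIV (\<lambda>_::nat. timed_state :: (real \<times> 's) measure)"
  proof (rule measurable_PiM_single')
    fix i :: nat
    have "(\<lambda>\<tau>. \<tau> i) \<in> borel_measurable (timed_seq :: (nat \<Rightarrow> real \<times> 's) measure)"
      unfolding timed_seq_def by (rule measurable_restrict_space1) (rule measurable_coord)
    moreover have "(\<lambda>\<tau>. \<tau> i) \<in> space timed_seq \<rightarrow> {0..} \<times> (UNIV :: 's set)"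
      by (auto simp: timed_seq_def space_restrict_space mem_Times_iff)
    ultimately show "(\<lambda>\<tau>. \<tau> i) \<in> timed_seq \<rightarrow>\<^sub>M (timed_state :: (real \<times> 's) measure)"
      unfolding timed_state_def by (intro measurable_restrict_space2)
  qed (auto simp: space_timed_seq space_PiM)
  then show "sets (PiM UNIV (\<lambda>_::nat. timed_state :: (real \<times> 's) measure)) \<subseteq> sets timed_seq"
    by (rule sets_subset_of_measurable_ident) (rule space_timed_seq)
next
  have "(\<lambda>\<tau>. \<tau> i) \<in> borel_measurable (PiM UNIV (\<lambda>_. timed_state :: (real \<times> 's) measure))" for i :: nat
  proof (rule measurable_compose[OF measurable_component_singleton])
    show "(\<lambda>x. x) \<in> borel_measurable (timed_state :: (real \<times> 's) measure)"
      unfolding timed_state_def by (rule measurable_restrict_space1) measurable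
  qed simp
  then have "(\<lambda>x. x) \<in> borel_measurable (PiM UNIV (\<lambda>_::nat. timed_state :: (real \<times> 's) measure))"
    by (rule measurable_coordinatewise_then_product)
  moreover have "(\<lambda>x. x) \<in> space (PiM UNIV (\<lambda>_::nat. timed_state :: (real \<times> 's) measure))
      \<rightarrow> {\<tau>. \<forall>i. 0 \<le> fst (\<tau> i)}"
    by (auto simp: timed_state_def space_restrict_space space_PiM PiE_iff mem_Times_iff)
  ultimately have "(\<lambda>x. x) \<in> PiM UNIV (\<lambda>_::nat. timed_state :: (real \<times> 's) measure) \<rightarrow>\<^sub>M timed_seq"
    unfolding timed_seq_def by (intro measurable_restrict_space2)
  then show "sets timed_seq \<subseteq> sets (PiM UNIV (\<lambda>_::nat. timed_state :: (real \<times> 's) measure))"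
    by (rule sets_subset_of_measurable_ident) (rule space_timed_seq[symmetric])
qed

section \<open>Finite-dimensional kernels\<close>

lemma prob_space_kernel:
  assumes "stochastic_relation borel timed_state M" "\<And>s. emeasure (M s) (space timed_state) = 1"
  shows "prob_space (M s)"
proof -
  have "sets (M s) = sets timed_state"
    using assms(1) unfolding stochastic_relation_def by (rule sets_kernel) simp
  then show ?thesis
    using assms(2) by (intro prob_spaceI) (metis sets_eq_imp_space_eq)
qed

text \<open>Law of the whole extended history rather than of the new coordinate alone, so that the
  recursion for \<open>fin_kernel\<close> becomes a Giry bind.\<close>

definition step_kernel ::
  "('s::polish_space \<Rightarrow> (real \<times> 's) measure) \<Rightarrow> nat \<Rightarrow> (nat \<Rightarrow> real \<times> 's) \<Rightarrow> (nat \<Rightarrow> real \<times> 's) measure" where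
  "step_kernel M n x = distr (M (snd (x n))) (\<Pi>\<^sub>M i\<in>{..Suc n}. timed_state) (\<lambda>y. x(Suc n := y))"

lemma measurable_snd_timed_state [measurable]: "snd \<in> borel_measurable timed_state"
  unfolding timed_state_def by (rule measurable_restrict_space1) measurable

lemma measurable_step_kernel:
  assumes [measurable]: "M \<in> borel \<rightarrow>\<^sub>M subprob_algebra timed_state"
  shows "step_kernel M n \<in> (\<Pi>\<^sub>M i\<in>{..n}. timed_state) \<rightarrow>\<^sub>M subprob_algebra (\<Pi>\<^sub>M i\<in>{..Suc n}. timed_state)"
  unfolding step_kernel_def
proof (rule measurable_distr2)
  show "(\<lambda>(x, y). x(Suc n := y)) \<in> (\<Pi>\<^sub>M i\<in>{..n}. timed_state) \<Otimes>\<^sub>M timed_state \<rightarrow>\<^sub>M (\<Pi>\<^sub>M i\<in>{..Suc n}. timed_state)"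
    unfolding measurable_split_conv
    by (rule measurable_fun_upd[where J="{..n}"]) auto
  have "(\<lambda>x. snd (x n)) \<in> borel_measurable (\<Pi>\<^sub>M i\<in>{..n}. timed_state)"
    by measurable
  then show "(\<lambda>x. M (snd (x n))) \<in> (\<Pi>\<^sub>M i\<in>{..n}. timed_state) \<rightarrow>\<^sub>M subprob_algebra timed_state"
    by (rule measurable_compose) fact
qed

text \<open>The recursion hands \<open>measure_of\<close> a bare set function; its agreement with
  the measure of a bind supplies countable additivity, so that \<open>emeasure\<close> returns the
  intended integral.\<close>

lemma fin_kernel_Suc:
  assumes M: "M \<in> borel \<rightarrow>\<^sub>M subprob_algebra timed_state"
    and n: "fin_kernel M n s \<in> space (subprob_algebra (\<Pi>\<^sub>M i\<in>{..n}. timed_state))"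
  shows "fin_kernel M (Suc n) s = fin_kernel M n s \<bind> step_kernel M n"
proof -
  let ?N = "fin_kernel M n s \<bind> step_kernel M n"
  \<comment> \<open>Non-emptiness matters because \<open>bind\<close> takes a default value on an
    empty space.\<close>
  have sets_n: "sets (fin_kernel M n s) = sets (\<Pi>\<^sub>M i\<in>{..n}. timed_state)"
    and ne: "space (fin_kernel M n s) \<noteq> {}"
    using n by (auto simp: space_subprob_algebra dest: subprob_space.subprob_not_empty)
  have step: "step_kernel M n \<in> fin_kernel M n s \<rightarrow>\<^sub>M subprob_algebra (\<Pi>\<^sub>M i\<in>{..Suc n}. timed_state)"
    using measurable_step_kernel[OF M] by (simp add: measurable_cong_sets[OF sets_n refl])
  have sets_N: "sets ?N = sets (\<Pi>\<^sub>M i\<in>{..Suc n}. timed_state)"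
    using step ne by (intro sets_bind) (auto dest: sets_kernel)
  have eq: "(\<integral>\<^sup>+x. emeasure (M (snd (x n))) {y \<in> space timed_state. x(Suc n := y) \<in> D} \<partial>fin_kernel M n s)
      = emeasure ?N D" if D: "D \<in> sets (\<Pi>\<^sub>M i\<in>{..Suc n}. timed_state)" for D
  proof -
    have "emeasure ?N D = (\<integral>\<^sup>+x. emeasure (step_kernel M n x) D \<partial>fin_kernel M n s)"
      by (rule emeasure_bind[OF ne step D])
    also have "\<dots> = (\<integral>\<^sup>+x. emeasure (M (snd (x n))) {y \<in> space timed_state. x(Suc n := y) \<in> D} \<partial>fin_kernel M n s)"
    proof (rule nn_integral_cong)
      fix x assume "x \<in> space (fin_kernel M n s)"
      then have x: "x \<in> space (\<Pi>\<^sub>M i\<in>{..n}. timed_state)"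
        using sets_eq_imp_space_eq[OF sets_n] by simp
      have sM: "sets (M (snd (x n))) = sets timed_state"
        using M by (rule sets_kernel) simp
      have "(\<lambda>y. x(Suc n := y)) \<in> M (snd (x n)) \<rightarrow>\<^sub>M (\<Pi>\<^sub>M i\<in>{..Suc n}. timed_state)"
        unfolding measurable_cong_sets[OF sM refl]
        using x by (intro measurable_fun_upd[where J="{..n}"]) auto
      then show "emeasure (step_kernel M n x) D
          = emeasure (M (snd (x n))) {y \<in> space timed_state. x(Suc n := y) \<in> D}"
        using D sets_eq_imp_space_eq[OF sM]
        by (simp add: step_kernel_def emeasure_distr vimage_def Int_def conj_commute)
    qed
    finally show ?thesis by simp
  qed
  \<comment> \<open>\<open>measure_of\<close> depends on its set function only on the generated
    sigma-algebra, where \<open>eq\<close> applies; rebuilding a measure from its own data then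
    gives it back.\<close>
  have "fin_kernel M (Suc n) s = measure_of (space ?N) (sets ?N) (emeasure ?N)"
    unfolding fin_kernel.simps sets_N sets_eq_imp_space_eq[OF sets_N]
    by (rule measure_of_eq) (auto simp: sets.space_closed sets.sigma_sets_eq eq)
  then show ?thesis
    by (simp only: measure_of_of_measure)
qed

text \<open>Interleaved induction: the hypothesis at \<open>n\<close> also says that each
  \<open>fin_kernel M n s\<close> is a subprobability measure, which is what
  \<open>fin_kernel_Suc\<close> requires to turn the next stage into a bind of measurable
  kernels.\<close>

lemma measurable_fin_kernel:
  assumes M: "M \<in> borel \<rightarrow>\<^sub>M subprob_algebra timed_state"
  shows "fin_kernel M n \<in> borel \<rightarrow>\<^sub>M subprob_algebra (\<Pi>\<^sub>M i\<in>{..n}. timed_state)"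
proof (induction n)
  case 0
  have "(\<lambda>s. distr (M s) (\<Pi>\<^sub>M i\<in>{..0}. timed_state) (\<lambda>y. \<lambda>i\<in>{..0}. y))
      \<in> borel \<rightarrow>\<^sub>M subprob_algebra (\<Pi>\<^sub>M i\<in>{..0::nat}. timed_state)"
    by (rule measurable_distr2[OF _ M]) (auto simp: split_beta' intro!: measurable_restrict)
  also have "(\<lambda>s. distr (M s) (\<Pi>\<^sub>M i\<in>{..0}. timed_state) (\<lambda>y. \<lambda>i\<in>{..0}. y)) = fin_kernel M 0"
    by (rule ext) simp
  finally show ?case .
next
  case (Suc n)
  have "(\<lambda>s. fin_kernel M n s \<bind> step_kernel M n)
      \<in> borel \<rightarrow>\<^sub>M subprob_algebra (\<Pi>\<^sub>M i\<in>{..Suc n}. timed_state)"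
    by (rule measurable_bind2[OF Suc measurable_step_kernel[OF M]])
  also have "(\<lambda>s. fin_kernel M n s \<bind> step_kernel M n) = fin_kernel M (Suc n)"
    using measurable_space[OF Suc] by (intro ext fin_kernel_Suc[OF M, symmetric]) simp
  finally show ?case .
qed

section \<open>Existence, uniqueness and measurability of the infinite-path kernel\<close>

definition path_kernel_spec ::
  "('s::polish_space \<Rightarrow> (real \<times> 's) measure) \<Rightarrow> 's \<Rightarrow> (nat \<Rightarrow> real \<times> 's) measure \<Rightarrow> bool" where
  "path_kernel_spec M s N \<longleftrightarrow> sets N = sets timed_seq \<and>
     (\<forall>n. \<forall>A \<in> sets (\<Pi>\<^sub>M i\<in>{..n}. timed_state).
        emeasure N {\<tau> \<in> space timed_seq. restrict \<tau> {..n} \<in> A} = emeasure (fin_kernel M n s) A)"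

text \<open>For a fixed start state the measure is the Ionescu-Tulcea projective limit; dependence
  on \<open>s\<close> is treated only afterwards.\<close>

lemma path_kernel_spec_exists:
  fixes M :: "'s::polish_space \<Rightarrow> (real \<times> 's) measure"
  assumes M: "M \<in> borel \<rightarrow>\<^sub>M subprob_algebra timed_state"
    and prob: "\<And>s. prob_space (M s)"
  shows "\<exists>N. path_kernel_spec M s N \<and> prob_space N"
proof -
  \<comment> \<open>Transitions in the form the theorem wants, depending on the whole history: the
    first starts from \<open>s\<close>, which is not a coordinate of the sequence, and every later
    one from the last recorded state.\<close>
  define P where "P i x = (case i of 0 \<Rightarrow> M s | Suc j \<Rightarrow> M (snd (x j)))"
    for i :: nat and x :: "nat \<Rightarrow> real \<times> 's"
  have P_0: "P 0 x = M s" and P_Suc: "P (Suc j) x = M (snd (x j))" for x j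
    by (simp_all add: P_def)
  interpret IT: Ionescu_Tulcea P "\<lambda>_. timed_state"
  proof (rule Ionescu_Tulcea.intro)
    fix i :: nat
    show "P i \<in> (\<Pi>\<^sub>M i\<in>{0..<i}. timed_state) \<rightarrow>\<^sub>M subprob_algebra timed_state"
    proof (cases i)
      case 0
      then show ?thesis
        using measurable_space[OF M] by (simp add: P_def[abs_def])
    next
      case (Suc j)
      have "(\<lambda>x. snd (x j)) \<in> borel_measurable (\<Pi>\<^sub>M i\<in>{0..<i}. timed_state)"
        using Suc by (intro measurable_compose[OF _ measurable_snd_timed_state]) simp
      moreover have "P i = (\<lambda>x. M (snd (x j)))"
        by (simp add: P_def[abs_def] Suc)
      ultimately show ?thesis
        by (simp only:) (erule measurable_compose[OF _ M])
    qed
    show "prob_space (P i x)" for x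
      by (cases i) (simp_all add: P_def prob)
  qed
  \<comment> \<open>Index shift: \<open>fin_kernel M n\<close> has the \<open>n + 1\<close>
    coordinates \<open>{..n}\<close>, hence \<open>Suc n\<close> steps from the empty history, which
    is encoded as the function \<open>\<lambda>_. undefined\<close>.\<close>
  have fin: "fin_kernel M n s = IT.C 0 (Suc n) (\<lambda>_. undefined)" for n
  proof (induction n)
    case 0
    have "fin_kernel M 0 s = distr (M s) (\<Pi>\<^sub>M i\<in>{0..<Suc 0}. timed_state) (fun_upd (\<lambda>_. undefined) 0)"
      by (auto simp: fun_eq_iff restrict_def intro!: arg_cong2[where f="distr (M s)"])
    also have "\<dots> = IT.eP 0 (\<lambda>_. undefined)"
      by (simp add: IT.eP_def P_0)
    also have "\<dots> = IT.C 0 (Suc 0) (\<lambda>_. undefined)"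
      using bind_return[OF IT.measurable_eP[of 0], of "\<lambda>_. undefined"] by (simp add: space_PiM)
    finally show ?case .
  next
    case (Suc n)
    have "step_kernel M n = IT.eP (Suc n)"
      by (simp add: fun_eq_iff step_kernel_def IT.eP_def P_Suc atLeast0LessThan lessThan_Suc_atMost)
    then show ?case
      using fin_kernel_Suc[OF M measurable_space[OF measurable_fin_kernel[OF M]], of s n] Suc
      by (simp del: fin_kernel.simps)
  qed
  have sets: "sets IT.PF.lim = sets timed_seq"
    by (simp add: sets_timed_seq)
  have eq: "emeasure IT.PF.lim {\<tau> \<in> space timed_seq. restrict \<tau> {..n} \<in> A} = emeasure (fin_kernel M n s) A"
    if A: "A \<in> sets (\<Pi>\<^sub>M i\<in>{..n}. timed_state)" for n A
  proof -
    have J: "{..n} = {0..<Suc n}" by auto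
    have "{\<tau> \<in> space timed_seq. restrict \<tau> {..n} \<in> A} = IT.PF.emb UNIV {0..<Suc n} A"
      by (auto simp: space_timed_seq prod_emb_def space_PiM J)
    then have "emeasure IT.PF.lim {\<tau> \<in> space timed_seq. restrict \<tau> {..n} \<in> A} = IT.CI {0..<Suc n} A"
      using A by (simp only: J) (rule IT.lim, auto)
    also have "\<dots> = emeasure (fin_kernel M n s) A"
      unfolding fin using A sets.sets_into_space[OF A]
      by (subst IT.emeasure_CI[where n="Suc n"]) (auto simp: J prod_emb_id space_PiM)
    finally show ?thesis .
  qed
  have "prob_space IT.PF.lim"
  proof (rule prob_spaceI)
    let ?X = "space (\<Pi>\<^sub>M i\<in>{..0::nat}. timed_state :: (real \<times> 's) measure)"
    \<comment> \<open>Total mass is read off from the cylinder over the full one-coordinate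
      space.\<close>
    have "space IT.PF.lim = {\<tau> \<in> space timed_seq. restrict \<tau> {..0} \<in> ?X}"
      by (auto simp: space_timed_seq space_PiM)
    then have "emeasure IT.PF.lim (space IT.PF.lim) = emeasure (fin_kernel M 0 s) ?X"
      using eq[of ?X 0] by (simp del: fin_kernel.simps)
    also have "\<dots> = emeasure (IT.C 0 (Suc 0) (\<lambda>_. undefined)) (space (IT.C 0 (Suc 0) (\<lambda>_. undefined)))"
      by (subst IT.space_C) (simp_all add: fin space_PiM atLeast0LessThan lessThan_Suc_atMost
          del: fin_kernel.simps IT.C.simps)
    also have "\<dots> = 1"
      by (intro prob_space.emeasure_space_1 IT.prob_space_C) (simp add: space_PiM)
    finally show "emeasure IT.PF.lim (space IT.PF.lim) = 1" .
  qed
  moreover have "path_kernel_spec M s IT.PF.lim"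
    unfolding path_kernel_spec_def using sets eq by blast
  ultimately show ?thesis
    by blast
qed

text \<open>The specification covers bases \<open>{..n}\<close> only, while the generating
  rectangles of the product have an arbitrary finite base \<open>J\<close>; enlarging
  \<open>J\<close> to an initial segment bridges the two.\<close>

lemma path_kernel_spec_emb:
  assumes N: "path_kernel_spec M s N" and J: "J \<subseteq> {..n}"
    and X: "X \<in> sets (\<Pi>\<^sub>M i\<in>J. timed_state)"
  shows "emeasure N (prod_emb UNIV (\<lambda>_. timed_state) J X)
    = emeasure (fin_kernel M n s) (prod_emb {..n} (\<lambda>_. timed_state) J X)"
proof -
  have "prod_emb UNIV (\<lambda>_. timed_state) J X
      = {\<tau> \<in> space timed_seq. restrict \<tau> {..n} \<in> prod_emb {..n} (\<lambda>_. timed_state) J X}"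
    using J by (auto simp: prod_emb_def space_timed_seq space_PiM Int_absorb1 PiE_iff)
  then show ?thesis
    using N J X by (auto simp: path_kernel_spec_def)
qed

text \<open>Rectangles with finite base are stable under intersection and generate the
  sigma-algebra, so agreement on them suffices, given finiteness of \<open>N\<close>.\<close>

lemma path_kernel_spec_unique:
  fixes M :: "'s::polish_space \<Rightarrow> (real \<times> 's) measure"
  assumes N: "path_kernel_spec M s N" and N': "path_kernel_spec M s N'" and "finite_measure N"
  shows "N = N'"
proof (rule measure_eqI_PiM_infinite)
  show "sets N = sets (PiM UNIV (\<lambda>_. timed_state))" "sets N' = sets (PiM UNIV (\<lambda>_. timed_state))"
    using N N' by (auto simp: path_kernel_spec_def sets_timed_seq)
next
  fix A :: "nat \<Rightarrow> (real \<times> 's) set" and J :: "nat set"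
  assume J: "finite J" and A: "\<And>i. i \<in> J \<Longrightarrow> A i \<in> sets timed_state"
  then obtain n where n: "J \<subseteq> {..n}"
    by (auto simp: finite_nat_set_iff_bounded_le)
  show "emeasure N (prod_emb UNIV (\<lambda>_. timed_state) J (Pi\<^sub>E J A))
      = emeasure N' (prod_emb UNIV (\<lambda>_. timed_state) J (Pi\<^sub>E J A))"
    using J A by (subst (1 2) path_kernel_spec_emb[OF _ n]) (auto intro: N N' sets_PiM_I_finite)
qed fact

text \<open>Dynkin argument: it suffices to test evaluation on rectangles, where it is an evaluation
  of some \<open>fin_kernel M n\<close>, and on the whole space, where it is constantly 1.\<close>

lemma path_kernel_spec_measurable:
  fixes K :: "'s::polish_space \<Rightarrow> (nat \<Rightarrow> real \<times> 's) measure"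
  assumes M: "M \<in> borel \<rightarrow>\<^sub>M subprob_algebra timed_state"
    and K: "\<And>s. path_kernel_spec M s (K s)" "\<And>s. prob_space (K s)"
  shows "K \<in> borel \<rightarrow>\<^sub>M subprob_algebra timed_seq"
proof (rule measurable_subprob_algebra_generated)
  show "sets (timed_seq :: (nat \<Rightarrow> real \<times> 's) measure)
      = sigma_sets (\<Pi>\<^sub>E i\<in>UNIV. space timed_state) (prod_algebra UNIV (\<lambda>_. timed_state))"
    by (simp add: sets_timed_seq sets_PiM)
  show "Int_stable (prod_algebra (UNIV :: nat set) (\<lambda>_. timed_state :: (real \<times> 's) measure))"
    by (rule Int_stable_prod_algebra)
  show "prod_algebra (UNIV :: nat set) (\<lambda>_. timed_state :: (real \<times> 's) measure)
      \<subseteq> Pow (\<Pi>\<^sub>E i\<in>UNIV. space timed_state)"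
    by (rule prod_algebra_sets_into_space)
  show "subprob_space (K s)" for s
    using K(2) by (rule prob_space_imp_subprob_space)
  show sets_K: "sets (K s) = sets timed_seq" for s
    using K(1) by (simp add: path_kernel_spec_def)
  show "(\<lambda>s. emeasure (K s) A) \<in> borel_measurable borel"
    if "A \<in> prod_algebra UNIV (\<lambda>_. timed_state)" for A
    using that
  proof (cases rule: prod_algebraE)
    case (1 J E)
    obtain n where n: "J \<subseteq> {..n}"
      using 1 by (auto simp: finite_nat_set_iff_bounded_le)
    have E: "Pi\<^sub>E J E \<in> sets (\<Pi>\<^sub>M i\<in>J. timed_state)"
      using 1 by (auto intro: sets_PiM_I_finite)
    have "prod_emb {..n} (\<lambda>_. timed_state) J (Pi\<^sub>E J E) \<in> sets (\<Pi>\<^sub>M i\<in>{..n}. timed_state)"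
      using n E by auto
    then show ?thesis
      unfolding 1(1) path_kernel_spec_emb[OF K(1) n E]
      by (rule measurable_emeasure_kernel[OF measurable_fin_kernel[OF M]])
  qed
  have "emeasure (K s) (\<Pi>\<^sub>E i\<in>UNIV. space timed_state) = 1" for s
    using prob_space.emeasure_space_1[OF K(2)] sets_eq_imp_space_eq[OF sets_K]
    by (simp add: space_timed_seq space_PiM)
  then show "(\<lambda>s. emeasure (K s) (\<Pi>\<^sub>E i\<in>UNIV. space timed_state)) \<in> borel_measurable borel"
    by simp
qed

text \<open>Discharges the definite description in \<open>path_kernel\<close>: the pointwise chosen
  limits form a measurable kernel and hence a witness, and any competitor meets the pointwise
  specification at every \<open>s\<close>, where uniqueness applies.\<close>

lemma measurable_path_kernel:
  assumes M: "M \<in> borel \<rightarrow>\<^sub>M subprob_algebra timed_state"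
    and prob: "\<And>s. prob_space (M s)"
  shows "path_kernel M \<in> borel \<rightarrow>\<^sub>M subprob_algebra timed_seq"
proof -
  obtain K where K: "\<And>s. path_kernel_spec M s (K s)" "\<And>s. prob_space (K s)"
    using path_kernel_spec_exists[OF M prob] by metis
  have meas: "K \<in> borel \<rightarrow>\<^sub>M subprob_algebra timed_seq"
    using path_kernel_spec_measurable[OF M K] .
  have "path_kernel M = K"
    unfolding path_kernel_def
  proof (rule the_equality)
    show "stochastic_relation borel timed_seq K \<and>
     (\<forall>s n. \<forall>A \<in> sets (\<Pi>\<^sub>M i\<in>{..n}. timed_state).
        emeasure (K s) {\<tau> \<in> space timed_seq. restrict \<tau> {..n} \<in> A} = emeasure (fin_kernel M n s) A)"
      using meas K(1) by (auto simp: stochastic_relation_def path_kernel_spec_def)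
  next
    fix K' assume K': "stochastic_relation borel timed_seq K' \<and>
     (\<forall>s n. \<forall>A \<in> sets (\<Pi>\<^sub>M i\<in>{..n}. timed_state).
        emeasure (K' s) {\<tau> \<in> space timed_seq. restrict \<tau> {..n} \<in> A} = emeasure (fin_kernel M n s) A)"
    then have "K' \<in> borel \<rightarrow>\<^sub>M subprob_algebra timed_seq"
      by (simp add: stochastic_relation_def)
    then have "sets (K' s) = sets timed_seq" for s
      by (rule sets_kernel) simp
    with K' have "path_kernel_spec M s (K' s)" for s
      by (simp add: path_kernel_spec_def)
    then show "K' = K"
      using K by (intro ext path_kernel_spec_unique[symmetric, OF K(1)]) (auto simp: prob_space.finite_measure)
  qed
  with meas show ?thesis by simp
qed

section \<open>States along a path and the until operator\<close>

definition holds_at :: "('s \<Rightarrow> bool) \<Rightarrow> (nat \<Rightarrow> 's \<times> real) \<Rightarrow> real \<Rightarrow> bool" where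
  "holds_at \<phi> \<sigma> t \<longleftrightarrow> (\<exists>s. state_at \<sigma> t = Some s \<and> \<phi> s)"

lemma state_at_eq_Some:
  assumes "t < (\<Sum>i\<le>k. delay \<sigma> i)" "\<And>j. j < k \<Longrightarrow> (\<Sum>i\<le>j. delay \<sigma> i) \<le> t"
  shows "state_at \<sigma> t = Some (state_nth \<sigma> k)"
proof -
  have "(LEAST k. t < (\<Sum>i\<le>k. delay \<sigma> i)) = k"
    using assms by (intro Least_equality) (auto simp: not_less[symmetric])
  then show ?thesis
    using assms(1) by (auto simp: state_at_def)
qed

lemma state_at_cases:
  obtains k where "t < (\<Sum>i\<le>k. delay \<sigma> i)" "\<And>j. j < k \<Longrightarrow> (\<Sum>i\<le>j. delay \<sigma> i) \<le> t"
      "state_at \<sigma> t = Some (state_nth \<sigma> k)"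
    | "\<And>k. (\<Sum>i\<le>k. delay \<sigma> i) \<le> t" "state_at \<sigma> t = None"
proof (cases "\<exists>k. t < (\<Sum>i\<le>k. delay \<sigma> i)")
  case True
  define k where "k = (LEAST k. t < (\<Sum>i\<le>k. delay \<sigma> i))"
  have "t < (\<Sum>i\<le>k. delay \<sigma> i)"
    unfolding k_def using True by (rule LeastI_ex)
  moreover have "(\<Sum>i\<le>j. delay \<sigma> i) \<le> t" if "j < k" for j
    using not_less_Least[of j "\<lambda>k. t < (\<Sum>i\<le>k. delay \<sigma> i)"] that by (simp add: k_def)
  ultimately show ?thesis
    using that(1) state_at_eq_Some by blast
next
  case False
  then show ?thesis
    using that(2) by (auto simp: state_at_def not_less)
qed

text \<open>Spells out the \<open>LEAST\<close>: \<open>k\<close> is the first index whose partial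
  sum exceeds \<open>t\<close>. The result is a countable disjunction of conditions on finitely many
  coordinates, from which measurability can be read off.\<close>

lemma holds_at_iff:
  "holds_at \<phi> \<sigma> t \<longleftrightarrow>
    (\<exists>k. t < (\<Sum>i\<le>k. delay \<sigma> i) \<and> (\<forall>j<k. (\<Sum>i\<le>j. delay \<sigma> i) \<le> t) \<and> \<phi> (state_nth \<sigma> k))"
proof
  assume "holds_at \<phi> \<sigma> t"
  then show "\<exists>k. t < (\<Sum>i\<le>k. delay \<sigma> i) \<and> (\<forall>j<k. (\<Sum>i\<le>j. delay \<sigma> i) \<le> t) \<and> \<phi> (state_nth \<sigma> k)"
    by (cases t \<sigma> rule: state_at_cases) (auto simp: holds_at_def)
qed (auto simp: holds_at_def dest: state_at_eq_Some)

text \<open>A state is left only when its partial sum is reached, so up to that sum the least index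
  does not change. Past every partial sum the value remains \<open>None\<close>, and
  \<open>t + 1\<close> is just some later time.\<close>

lemma state_at_right_constant:
  obtains u where "t < u" "\<And>t'. t \<le> t' \<Longrightarrow> t' < u \<Longrightarrow> state_at \<sigma> t' = state_at \<sigma> t"
proof (cases t \<sigma> rule: state_at_cases)
  case (1 k)
  then show ?thesis
    by (intro that[of "\<Sum>i\<le>k. delay \<sigma> i"]) (auto intro!: state_at_eq_Some intro: order_trans)
next
  case 2
  have "state_at \<sigma> t' = None" if "t \<le> t'" for t'
  proof -
    have "\<not> t' < (\<Sum>i\<le>k. delay \<sigma> i)" for k
      using 2(1)[of k] that by simp
    then show ?thesis by (simp add: state_at_def)
  qed
  then show ?thesis
    using 2(2) by (intro that[of "t + 1"]) auto
qed

lemma holds_before_iff_rat: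
  "(\<forall>t'\<in>{0..<t}. holds_at \<phi> \<sigma> t') \<longleftrightarrow>
    (\<forall>q::rat. 0 \<le> q \<longrightarrow> of_rat q < t \<longrightarrow> holds_at \<phi> \<sigma> (of_rat q))"
proof (intro iffI ballI)
  fix t' assume rat: "\<forall>q::rat. 0 \<le> q \<longrightarrow> of_rat q < t \<longrightarrow> holds_at \<phi> \<sigma> (of_rat q)"
    and t': "t' \<in> {0..<t}"
  obtain u where u: "t' < u" "\<And>r. t' \<le> r \<Longrightarrow> r < u \<Longrightarrow> state_at \<sigma> r = state_at \<sigma> t'"
    using state_at_right_constant[of t' \<sigma>] by blast
  \<comment> \<open>The rational is taken strictly after \<open>t'\<close>, before the state changes
    and before \<open>t\<close>, so that the assumption applies to it and its state is the one at
    \<open>t'\<close>.\<close>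
  then obtain q where q: "t' < of_rat q" "of_rat q < min t u"
    using of_rat_dense[of t' "min t u"] t' by auto
  have "0 < (of_rat q :: real)"
    by (rule le_less_trans[OF _ q(1)]) (use t' in simp)
  then have "0 \<le> q"
    by simp
  with rat q have "holds_at \<phi> \<sigma> (of_rat q)"
    by auto
  with u(2)[of "of_rat q"] q show "holds_at \<phi> \<sigma> t'"
    by (simp add: holds_at_def)
qed auto

text \<open>Within the sojourn in the \<open>k\<close>-th state the earliest admissible time is the best witness,
  since the condition on earlier times only weakens as the witness decreases.\<close>

lemma until_iff:
  assumes \<sigma>: "\<And>i. 0 \<le> delay \<sigma> i" and a: "0 \<le> a"
    and I: "a \<in> I" "\<And>t. t \<in> I \<Longrightarrow> a \<le> t" "\<And>t u. t \<in> I \<Longrightarrow> a \<le> u \<Longrightarrow> u \<le> t \<Longrightarrow> u \<in> I"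
  shows "(\<exists>t\<in>I. holds_at \<phi>' \<sigma> t \<and> (\<forall>t'\<in>{0..<t}. holds_at \<phi> \<sigma> t')) \<longleftrightarrow>
    (\<exists>k. let u = max a (\<Sum>i<k. delay \<sigma> i) in u \<in> I \<and> u < (\<Sum>i\<le>k. delay \<sigma> i) \<and>
      \<phi>' (state_nth \<sigma> k) \<and> (\<forall>t'\<in>{0..<u}. holds_at \<phi> \<sigma> t'))"
proof safe
  fix t assume t: "t \<in> I" "holds_at \<phi>' \<sigma> t" "\<forall>t'\<in>{0..<t}. holds_at \<phi> \<sigma> t'"
  from t(2) obtain k where k: "t < (\<Sum>i\<le>k. delay \<sigma> i)"
      "\<And>j. j < k \<Longrightarrow> (\<Sum>i\<le>j. delay \<sigma> i) \<le> t" "\<phi>' (state_nth \<sigma> k)"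
    unfolding holds_at_iff by auto
  \<comment> \<open>The sum over \<open>{..<k}\<close> is the entry time of state \<open>k\<close>;
    for \<open>k = 0\<close> it is empty, and \<open>0 \<le> a \<le> t\<close> takes over.\<close>
  have "(\<Sum>i<k. delay \<sigma> i) \<le> t"
  proof (cases k)
    case 0
    then show ?thesis using I(2)[OF t(1)] a by simp
  next
    case (Suc j)
    then show ?thesis using k(2)[of j] by (simp add: lessThan_Suc_atMost)
  qed
  then have "max a (\<Sum>i<k. delay \<sigma> i) \<le> t"
    using I(2)[OF t(1)] by simp
  with t k show "\<exists>k. let u = max a (\<Sum>i<k. delay \<sigma> i) in u \<in> I \<and> u < (\<Sum>i\<le>k. delay \<sigma> i) \<and>
      \<phi>' (state_nth \<sigma> k) \<and> (\<forall>t'\<in>{0..<u}. holds_at \<phi> \<sigma> t')"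
    using I(3)[OF t(1), of "max a (\<Sum>i<k. delay \<sigma> i)"]
    by (intro exI[of _ k]) (auto simp: Let_def)
next
  fix k assume k: "let u = max a (\<Sum>i<k. delay \<sigma> i) in u \<in> I \<and> u < (\<Sum>i\<le>k. delay \<sigma> i) \<and>
      \<phi>' (state_nth \<sigma> k) \<and> (\<forall>t'\<in>{0..<u}. holds_at \<phi> \<sigma> t')"
  define u where "u = max a (\<Sum>i<k. delay \<sigma> i)"
  \<comment> \<open>Nonnegative delays make the partial sums increase, so \<open>u\<close> is not
    before the entry time of state \<open>k\<close> and no earlier index qualifies.\<close>
  have "(\<Sum>i\<le>j. delay \<sigma> i) \<le> u" if "j < k" for j
    unfolding u_def using that \<sigma>
    by (intro max.coboundedI2 sum_mono2) auto
  then have "holds_at \<phi>' \<sigma> u"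
    using k unfolding holds_at_iff Let_def u_def[symmetric] by auto
  then show "\<exists>t\<in>I. holds_at \<phi>' \<sigma> t \<and> (\<forall>t'\<in>{0..<t}. holds_at \<phi> \<sigma> t')"
    using k unfolding Let_def u_def[symmetric] by auto
qed

section \<open>Measurability on the path space\<close>

lemma measurable_state_nth [measurable]:
  "(\<lambda>\<sigma>. state_nth \<sigma> i) \<in> borel_measurable (path_space :: (nat \<Rightarrow> 's::polish_space \<times> real) measure)"
  unfolding state_nth_def path_space_def
  by (intro measurable_restrict_space1 measurable_compose[OF measurable_coord measurable_fst_borel])

lemma measurable_delay [measurable]:
  "(\<lambda>\<sigma>. delay \<sigma> i) \<in> borel_measurable (path_space :: (nat \<Rightarrow> 's::polish_space \<times> real) measure)"
  unfolding delay_def path_space_def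
  by (intro measurable_restrict_space1 measurable_compose[OF measurable_coord measurable_snd_borel])

lemma measurable_holds_at:
  assumes [measurable]: "Measurable.pred borel \<phi>"
  shows "Measurable.pred (path_space :: (nat \<Rightarrow> 's::polish_space \<times> real) measure) (\<lambda>\<sigma>. holds_at \<phi> \<sigma> t)"
  unfolding holds_at_iff by measurable

text \<open>Extracts what \<open>until_iff\<close> uses from either shape of interval: a nonnegative
  least element, which exists by closedness on the left, and stability under moving down towards
  it.\<close>

lemma csl_intervalE:
  assumes "csl_interval I"
  obtains a where "0 \<le> a" "a \<in> I" "\<And>t. t \<in> I \<Longrightarrow> a \<le> t"
    "\<And>t u. t \<in> I \<Longrightarrow> a \<le> u \<Longrightarrow> u \<le> t \<Longrightarrow> u \<in> I"
  using assms unfolding csl_interval_def by (elim bexE conjE disjE) (auto intro: that)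

lemma csl_interval_borel: "csl_interval I \<Longrightarrow> I \<in> sets borel"
  by (auto simp: csl_interval_def)

lemma delay_nonneg: "\<sigma> \<in> space path_space \<Longrightarrow> 0 \<le> delay \<sigma> i"
  by (simp add: path_space_def space_restrict_space delay_def)

text \<open>Both uncountable quantifiers become countable: the witness time through
  \<open>until_iff\<close> with its index \<open>k\<close>, the earlier times through
  \<open>holds_before_iff_rat\<close>.\<close>

lemma measurable_until:
  assumes I: "csl_interval I"
    and \<phi>: "Measurable.pred borel \<phi>" and \<phi>': "Measurable.pred borel \<phi>'"
  shows "Measurable.pred (path_space :: (nat \<Rightarrow> 's::polish_space \<times> real) measure)
    (\<lambda>\<sigma>. \<exists>t\<in>I. holds_at \<phi>' \<sigma> t \<and> (\<forall>t'\<in>{0..<t}. holds_at \<phi> \<sigma> t'))"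
proof -
  obtain a where a: "0 \<le> a" "a \<in> I" "\<And>t. t \<in> I \<Longrightarrow> a \<le> t"
    "\<And>t u. t \<in> I \<Longrightarrow> a \<le> u \<Longrightarrow> u \<le> t \<Longrightarrow> u \<in> I"
    using csl_intervalE[OF I] by blast
  define u where "u k \<sigma> = max a (\<Sum>i<k. delay \<sigma> i)" for k and \<sigma> :: "nat \<Rightarrow> 's \<times> real"
  have u: "u k \<in> borel_measurable path_space" for k
    unfolding u_def[abs_def]
    by (intro borel_measurable_max borel_measurable_sum borel_measurable_const measurable_delay)
  have "Measurable.pred path_space (\<lambda>\<sigma>. of_rat q < u k \<sigma>)"
    and "Measurable.pred path_space (\<lambda>\<sigma>. u k \<sigma> < (\<Sum>i\<le>k. delay \<sigma> i))" for k q
    using u by measurable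
  then have "Measurable.pred path_space (\<lambda>\<sigma>. \<exists>k. u k \<sigma> \<in> I \<and> u k \<sigma> < (\<Sum>i\<le>k. delay \<sigma> i) \<and>
      \<phi>' (state_nth \<sigma> k) \<and> (\<forall>q::rat. 0 \<le> q \<longrightarrow> of_rat q < u k \<sigma> \<longrightarrow> holds_at \<phi> \<sigma> (of_rat q)))"
    by (intro pred_intros_countable pred_intros_logic pred_sets2[OF csl_interval_borel[OF I] u]
        measurable_compose[OF measurable_state_nth \<phi>'] measurable_holds_at \<phi>) auto
  \<comment> \<open>The rewriting by \<open>until_iff\<close> is a congruence on
    \<open>space path_space\<close>, where delays are nonnegative.\<close>
  then show ?thesis
    unfolding holds_before_iff_rat[symmetric] u_def
    by (subst measurable_cong[OF until_iff[OF _ a, unfolded Let_def]]) (auto simp: delay_nonneg)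
qed

lemma measurable_path_cons:
  "(\<lambda>(s, \<tau>). path_cons s \<tau>) \<in> borel \<Otimes>\<^sub>M timed_seq \<rightarrow>\<^sub>M (path_space :: (nat \<Rightarrow> 's::polish_space \<times> real) measure)"
proof -
  have 1: "(\<lambda>x. snd x i) \<in> borel_measurable (borel \<Otimes>\<^sub>M timed_seq :: ('s \<times> (nat \<Rightarrow> real \<times> 's)) measure)" for i
    unfolding timed_seq_def
    by (intro measurable_compose[OF measurable_snd] measurable_restrict_space1 measurable_coord)
  have "(\<lambda>x. path_cons (fst x) (snd x) i) \<in> borel_measurable (borel \<Otimes>\<^sub>M timed_seq :: ('s \<times> (nat \<Rightarrow> real \<times> 's)) measure)" for i
    unfolding path_cons_def
  proof (rule borel_measurable_Pair)
    show "(\<lambda>x. case i of 0 \<Rightarrow> fst x | Suc j \<Rightarrow> snd (snd x j))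
        \<in> borel_measurable (borel \<Otimes>\<^sub>M timed_seq :: ('s \<times> (nat \<Rightarrow> real \<times> 's)) measure)"
      by (cases i) (auto intro: measurable_compose[OF 1 measurable_snd_borel])
    show "(\<lambda>x. fst (snd x i)) \<in> borel_measurable (borel \<Otimes>\<^sub>M timed_seq :: ('s \<times> (nat \<Rightarrow> real \<times> 's)) measure)"
      by (rule measurable_compose[OF 1 measurable_fst_borel])
  qed
  then have "(\<lambda>x. path_cons (fst x) (snd x)) \<in> borel_measurable (borel \<Otimes>\<^sub>M timed_seq :: ('s \<times> (nat \<Rightarrow> real \<times> 's)) measure)"
    by (rule measurable_coordinatewise_then_product)
  moreover have "(\<lambda>x. path_cons (fst x) (snd x)) \<in> space (borel \<Otimes>\<^sub>M timed_seq :: ('s \<times> (nat \<Rightarrow> real \<times> 's)) measure) \<rightarrow> {\<sigma>. \<forall>i. 0 \<le> snd (\<sigma> i)}"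
    by (auto simp: space_pair_measure timed_seq_def space_restrict_space path_cons_def)
  ultimately show ?thesis
    unfolding path_space_def split_beta' by (intro measurable_restrict_space2)
qed

section \<open>Steady-state formulas\<close>

text \<open>A bound violated at a real time is violated on an interval to its right, by
  right-continuity, hence at a rational time there. The non-strict bound makes its negation an open
  condition.\<close>

lemma tendsto_at_top_iff_rat:
  fixes f :: "real \<Rightarrow> real"
  assumes right: "\<And>t. (f \<longlongrightarrow> f t) (at_right t)"
  shows "(f \<longlongrightarrow> L) at_top \<longleftrightarrow>
    (\<forall>m::nat. \<exists>N::nat. \<forall>q::rat. of_nat N \<le> q \<longrightarrow> \<bar>f (of_rat q) - L\<bar> \<le> 1 / Suc m)"
proof safe
  fix m :: nat
  assume "(f \<longlongrightarrow> L) at_top"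
  then have "eventually (\<lambda>t. dist (f t) L < 1 / Suc m) at_top"
    by (rule tendstoD) simp
  then obtain T where T: "\<And>t. T \<le> t \<Longrightarrow> dist (f t) L < 1 / Suc m"
    by (auto simp: eventually_at_top_linorder)
  obtain N :: nat where N: "T \<le> of_nat N"
    using real_arch_simple by blast
  have "\<bar>f (of_rat q) - L\<bar> \<le> 1 / Suc m" if "of_nat N \<le> q" for q :: rat
  proof -
    have "real N \<le> of_rat q"
      using that by (metis of_rat_less_eq of_rat_of_nat_eq)
    then show ?thesis
      using T[of "of_rat q"] N by (simp add: dist_real_def)
  qed
  then show "\<exists>N::nat. \<forall>q::rat. of_nat N \<le> q \<longrightarrow> \<bar>f (of_rat q) - L\<bar> \<le> 1 / Suc m"
    by blast
next
  assume *: "\<forall>m::nat. \<exists>N::nat. \<forall>q::rat. of_nat N \<le> q \<longrightarrow> \<bar>f (of_rat q) - L\<bar> \<le> 1 / Suc m"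
  show "(f \<longlongrightarrow> L) at_top"
  proof (rule tendstoI)
    fix e :: real assume "0 < e"
    then obtain m :: nat where m: "1 / Suc m < e"
      using reals_Archimedean[of e] by (auto simp: inverse_eq_divide)
    obtain N :: nat where N: "\<And>q::rat. of_nat N \<le> q \<Longrightarrow> \<bar>f (of_rat q) - L\<bar> \<le> 1 / Suc m"
      using * by blast
    have "dist (f t) L < e" if t: "real N \<le> t" for t
    proof (rule ccontr)
      assume "\<not> dist (f t) L < e"
      then have "1 / Suc m < \<bar>f t - L\<bar>"
        using m by (simp add: dist_real_def)
      moreover have "((\<lambda>r. \<bar>f r - L\<bar>) \<longlongrightarrow> \<bar>f t - L\<bar>) (at_right t)"
        by (intro tendsto_intros right)
      ultimately have "eventually (\<lambda>r. 1 / Suc m < \<bar>f r - L\<bar>) (at_right t)"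
        by (rule order_tendstoD(1)[rotated])
      then obtain u where u: "t < u" "\<And>r. t < r \<Longrightarrow> r < u \<Longrightarrow> 1 / Suc m < \<bar>f r - L\<bar>"
        by (auto simp: eventually_at_right_field)
      obtain q :: rat where q: "t < of_rat q" "of_rat q < u"
        using of_rat_dense[OF u(1)] by blast
      have "real N \<le> of_rat q"
        using t q(1) by (rule order_trans[OF _ less_imp_le])
      then have "of_nat N \<le> q"
        by (metis of_rat_less_eq of_rat_of_nat_eq)
      then show False
        using N[of q] u(2)[OF q] by simp
    qed
    then show "eventually (\<lambda>t. dist (f t) L < e) at_top"
      by (auto simp: eventually_at_top_linorder)
  qed
qed

text \<open>Eliminates the existential over \<open>L\<close>: a limit along the reals is also the
  limit along the naturals, and \<open>lim\<close> of a sequence depends measurably on a parameter.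
  If no limit exists, the rational test fails for whatever value \<open>lim\<close> takes.\<close>

lemma ex_limit_iff_rat:
  fixes f :: "real \<Rightarrow> real"
  assumes right: "\<And>t. (f \<longlongrightarrow> f t) (at_right t)"
  shows "(\<exists>L. (f \<longlongrightarrow> L) at_top \<and> R L) \<longleftrightarrow> (let L = lim (\<lambda>n. f (real n)) in
    (\<forall>m::nat. \<exists>N::nat. \<forall>q::rat. of_nat N \<le> q \<longrightarrow> \<bar>f (of_rat q) - L\<bar> \<le> 1 / Suc m) \<and> R L)"
proof -
  have "lim (\<lambda>n. f (real n)) = L" if "(f \<longlongrightarrow> L) at_top" for L
    using filterlim_compose[OF that filterlim_real_sequentially] by (rule limI)
  then show ?thesis
    unfolding Let_def tendsto_at_top_iff_rat[OF right, symmetric] by metis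
qed

lemma measure_holds_at_right_continuous:
  fixes N :: "(nat \<Rightarrow> real \<times> 's::polish_space) measure"
  assumes "finite_measure N"
    and sets: "\<And>t. {\<tau> \<in> space N. holds_at \<phi> (path_cons s \<tau>) t} \<in> sets N"
  shows "((\<lambda>t. measure N {\<tau> \<in> space N. holds_at \<phi> (path_cons s \<tau>) t})
    \<longlongrightarrow> measure N {\<tau> \<in> space N. holds_at \<phi> (path_cons s \<tau>) t}) (at_right t)"
proof (rule tendsto_at_right_sequentially)
  interpret finite_measure N by fact
  define A where "A r = {\<tau> \<in> space N. holds_at \<phi> (path_cons s \<tau>) r}" for r
  have A: "A r \<in> sets N" for r
    using sets by (simp add: A_def)
  fix S :: "nat \<Rightarrow> real" assume S: "\<And>n. t < S n" "S \<longlonglongrightarrow> t"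
  have "(\<lambda>n. \<integral>\<tau>. indicat_real (A (S n)) \<tau> \<partial>N) \<longlonglongrightarrow> (\<integral>\<tau>. indicat_real (A t) \<tau> \<partial>N)"
  \<comment> \<open>The constant 1 is integrable since \<open>N\<close> is finite; for each path the
    indicator is eventually constant along \<open>S\<close>, because the state does not change
    shortly after \<open>t\<close>.\<close>
  proof (rule integral_dominated_convergence[where w="\<lambda>_. 1"])
    show "AE \<tau> in N. (\<lambda>n. indicat_real (A (S n)) \<tau>) \<longlonglongrightarrow> indicat_real (A t) \<tau>"
    proof (rule AE_I2)
      fix \<tau> assume "\<tau> \<in> space N"
      obtain u where u: "t < u" "\<And>r. t \<le> r \<Longrightarrow> r < u \<Longrightarrow> state_at (path_cons s \<tau>) r = state_at (path_cons s \<tau>) t"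
        using state_at_right_constant[of t "path_cons s \<tau>"] by blast
      have "eventually (\<lambda>n. S n < u) sequentially"
        using S(2) u(1) by (rule order_tendstoD)
      then have "eventually (\<lambda>n. indicat_real (A (S n)) \<tau> = indicat_real (A t) \<tau>) sequentially"
        by eventually_elim
           (use S(1) u(2) in \<open>auto simp: A_def holds_at_def indicator_def less_imp_le\<close>)
      then show "(\<lambda>n. indicat_real (A (S n)) \<tau>) \<longlonglongrightarrow> indicat_real (A t) \<tau>"
        by (rule tendsto_eventually)
    qed
  qed (use A in \<open>auto split: split_indicator\<close>)
  then show "(\<lambda>n. measure N {\<tau> \<in> space N. holds_at \<phi> (path_cons s \<tau>) (S n)})
      \<longlonglongrightarrow> measure N {\<tau> \<in> space N. holds_at \<phi> (path_cons s \<tau>) t}"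
    using A by (simp add: A_def[symmetric])
qed (rule less_add_one)

text \<open>Both the measure and the event vary with \<open>s\<close>. The events are the sections
  of a single measurable subset of the product, so evaluating the kernel on them is
  measurable.\<close>

lemma measurable_path_measure:
  fixes K :: "'s::polish_space \<Rightarrow> (nat \<Rightarrow> real \<times> 's) measure"
  assumes K: "K \<in> borel \<rightarrow>\<^sub>M subprob_algebra timed_seq"
    and Q: "Measurable.pred path_space Q"
  shows "(\<lambda>s. measure (K s) {\<tau> \<in> space timed_seq. Q (path_cons s \<tau>)}) \<in> borel_measurable borel"
proof (rule measure_measurable_subprob_algebra2[OF _ K])
  have "Measurable.pred (borel \<Otimes>\<^sub>M timed_seq :: ('s \<times> _) measure) (\<lambda>x. Q ((\<lambda>(s, \<tau>). path_cons s \<tau>) x))"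
    by (rule measurable_compose[OF measurable_path_cons Q])
  then have "{x \<in> space (borel \<Otimes>\<^sub>M timed_seq). Q (path_cons (fst x) (snd x))} \<in> sets (borel \<Otimes>\<^sub>M timed_seq :: ('s \<times> _) measure)"
    by (simp add: pred_def split_beta')
  also have "{x \<in> space (borel \<Otimes>\<^sub>M timed_seq). Q (path_cons (fst x) (snd x))}
      = (SIGMA s:space borel. {\<tau> \<in> space timed_seq. Q (path_cons s \<tau>)})"
    by (auto simp: space_pair_measure)
  finally show "(SIGMA s:space borel. {\<tau> \<in> space timed_seq. Q (path_cons s \<tau>)}) \<in> sets (borel \<Otimes>\<^sub>M timed_seq)" .
qed

lemma measurable_cmp_rel:
  assumes [measurable]: "f \<in> borel_measurable N" "g \<in> borel_measurable N"
  shows "Measurable.pred N (\<lambda>x. cmp_rel c (f x) (g x))"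
  by (cases c) simp_all

lemma measurable_steady:
  fixes K :: "'s::polish_space \<Rightarrow> (nat \<Rightarrow> real \<times> 's) measure"
  assumes K: "K \<in> borel \<rightarrow>\<^sub>M subprob_algebra timed_seq"
    and \<phi>: "Measurable.pred borel \<phi>"
  shows "Measurable.pred borel (\<lambda>s. \<exists>L.
    ((\<lambda>t. measure (K s) {\<tau> \<in> space timed_seq. holds_at \<phi> (path_cons s \<tau>) t}) \<longlongrightarrow> L) at_top
      \<and> cmp_rel c L p)"
proof -
  define f where "f s t = measure (K s) {\<tau> \<in> space timed_seq. holds_at \<phi> (path_cons s \<tau>) t}" for s t
  have f [measurable]: "(\<lambda>s. f s t) \<in> borel_measurable borel" for t
    unfolding f_def by (intro measurable_path_measure[OF K] measurable_holds_at \<phi>)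
  have "(f s \<longlongrightarrow> f s t) (at_right t)" for s t
  proof -
    have sets: "sets (K s) = sets timed_seq"
      using K by (rule sets_kernel) simp
    have "subprob_space (K s)"
      using K by (rule subprob_space_kernel) simp
    then have "finite_measure (K s)"
      by (rule subprob_space.axioms)
    moreover have "{\<tau> \<in> space (K s). holds_at \<phi> (path_cons s \<tau>) t} \<in> sets (K s)" for t
    proof -
      have "(\<lambda>\<tau>. path_cons s \<tau>) \<in> timed_seq \<rightarrow>\<^sub>M path_space"
        using measurable_compose[OF measurable_Pair1' measurable_path_cons, of s] by simp
      then have "Measurable.pred timed_seq (\<lambda>\<tau>. holds_at \<phi> (path_cons s \<tau>) t)"
        by (rule measurable_compose) (rule measurable_holds_at[OF \<phi>])
      then show ?thesis
        by (simp add: pred_def sets sets_eq_imp_space_eq[OF sets])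
    qed
    ultimately show ?thesis
      using measure_holds_at_right_continuous[of "K s" \<phi> s t]
      by (simp add: f_def[abs_def] sets_eq_imp_space_eq[OF sets])
  qed
  note ex_limit_iff_rat[OF this]
  moreover have "Measurable.pred borel (\<lambda>s. let L = lim (\<lambda>n. f s (real n)) in
    (\<forall>m::nat. \<exists>N::nat. \<forall>q::rat. of_nat N \<le> q \<longrightarrow> \<bar>f s (of_rat q) - L\<bar> \<le> 1 / Suc m) \<and> cmp_rel c L p)"
    unfolding Let_def by (intro pred_intros_logic measurable_cmp_rel) measurable
  ultimately show ?thesis
    by (simp only: f_def[abs_def])
qed

theorem proposition2p190:
  fixes M :: "'s::polish_space \<Rightarrow> (real \<times> 's) measure"
    and P :: "'p set"
    and lab :: "'p \<Rightarrow> 's set"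
  assumes "stochastic_relation borel timed_state M"
    and "\<And>s. emeasure (M s) (space timed_state) = 1"
    and "countable P"
    and "\<And>a. a \<in> P \<Longrightarrow> lab a \<in> sets borel"
  shows "(\<forall>\<xi>. csl_state P \<xi> \<longrightarrow> {s. sat_state M lab \<xi> s} \<in> sets borel) \<and>
    (\<forall>\<xi>. csl_path P \<xi> \<longrightarrow> {\<sigma> \<in> space path_space. sat_path M lab \<xi> \<sigma>} \<in> sets path_space)"
proof -
  have K: "path_kernel M \<in> borel \<rightarrow>\<^sub>M subprob_algebra timed_seq"
    using assms(1) prob_space_kernel[OF assms(1,2)]
    by (intro measurable_path_kernel) (auto simp: stochastic_relation_def)
  \<comment> \<open>Measurable predicates rather than sets, so that constructors compose; both
    syntactic categories at once, as they are mutually recursive. \<open>Top\<close>,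
    \<open>Neg\<close> and \<open>Conj\<close> are left to the closing method.\<close>
  have "csl_state P \<xi> \<longrightarrow> Measurable.pred borel (sat_state M lab \<xi>)"
    and "csl_path P \<psi> \<longrightarrow> Measurable.pred path_space (sat_path M lab \<psi>)" for \<xi> \<psi>
  proof (induction \<xi> and \<psi>)
    case (Atom a)
    then show ?case
      using assms(4)[of a] by (simp add: pred_def)
  next
    case (Steady c p \<phi>)
    then show ?case
      using measurable_steady[OF K, of "sat_state M lab \<phi>" c] by (simp add: holds_at_def)
  next
    case (Prob c p \<psi>)
    then show ?case
      by (auto intro!: measurable_cmp_rel measurable_path_measure[OF K])
  next
    case (Next I \<phi>)
    show ?case
    proof
      assume "csl_path P (Next I \<phi>)"
      then have I: "I \<in> sets borel" and \<phi>: "Measurable.pred borel (sat_state M lab \<phi>)"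
        using Next by (auto simp: csl_interval_borel)
      have "Measurable.pred path_space (\<lambda>\<sigma>. sat_state M lab \<phi> (state_nth \<sigma> 1))"
        by (rule measurable_compose[OF measurable_state_nth \<phi>])
      moreover have "Measurable.pred path_space (\<lambda>\<sigma> :: nat \<Rightarrow> 's \<times> real. delay \<sigma> 0 \<in> I)"
        by (rule pred_sets2[OF I measurable_delay])
      ultimately show "Measurable.pred path_space (sat_path M lab (Next I \<phi>))"
        by simp
    qed
  next
    case (Until \<phi> I \<phi>')
    then show ?case
      using measurable_until[of I "sat_state M lab \<phi>" "sat_state M lab \<phi>'"]
      by (auto simp: holds_at_def)
  qed (auto intro!: pred_intros_logic)
  then show ?thesis
    by (simp add: pred_def)
qed

end
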